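(* The 12-dimensional Cohn-Elkies linear programming bound (i.e., the Cohn-Elkies linear programming bound in $\mathbb{R}^{12}$) is greater than or equal to $\frac{1}{24}>0.04166666$.
   Context: Fourier transform on $\mathbb{R}^d$: $\widehat f(y)=\int_{\mathbb{R}^d} f(x)e^{-2\pi i\langle x,y\rangle}\,dx$, where $\langle x,y\rangle=x_1y_1+\cdots+x_dy_d$. A function $f:\mathbb{R}^d\to\mathbb{R}$ is rapidly decreasing if $f(x)=O\left((1+|x|)^{-k}\right)$ for all positive integers $k$; it is radial if $f(x)$ depends only on $|x|$. For fixed $r>0$ and positive integer $d$, the Cohn-Elkies linear programming bound in $\mathbb{R}^d$ is the infimum of $\left(\frac r2\right)^d f(0)$ over all radial, smooth, rapidly decreasing functions $f:\mathbb{R}^d\to\mathbb{R}$ such that $f(0)>0$; $\widehat f(0)\geq 1$; $f(x)\leq 0$ for all $|x|\geq r$; and $\widehat f(y)\geq 0$ for all $y\in\mathbb{R}^d$. This value does not depend on $r$ (by rescaling $f$). *)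

theory Defs
  imports "HOL-Analysis.Analysis" "HOL-Library.Landau_Symbols" "HOL-Library.Complex_Order"
begin

definition fourier :: "('a::euclidean_space \<Rightarrow> real) \<Rightarrow> 'a \<Rightarrow> complex" where
  "fourier f y =
     (LINT x|lborel. complex_of_real (f x) * exp (- 2 * complex_of_real pi * \<i> * complex_of_real (x \<bullet> y)))"

definition radial :: "('a::euclidean_space \<Rightarrow> real) \<Rightarrow> bool" where
  "radial f \<longleftrightarrow> (\<forall>x y. norm x = norm y \<longrightarrow> f x = f y)"

text \<open>Only the function itself is required to decay, not its derivatives.\<close>

definition rapidly_decreasing :: "('a::euclidean_space \<Rightarrow> real) \<Rightarrow> bool" where
  "rapidly_decreasing f \<longleftrightarrow> (\<forall>k::nat. k > 0 \<longrightarrow> f \<in> O[at_infinity](\<lambda>x. 1 / (1 + norm x) ^ k))"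

text \<open>Class \<open>C\<^sup>k\<close> on the whole space, by recursion on the directional derivatives
  \<open>x \<mapsto> Df(x)(v)\<close>; since the space is finite-dimensional, continuity of all of these
  is continuity of the Frechet derivative.\<close>

primrec times_cont_differentiable :: "nat \<Rightarrow> ('a::euclidean_space \<Rightarrow> real) \<Rightarrow> bool" where
  "times_cont_differentiable 0 f \<longleftrightarrow> continuous_on UNIV f"
| "times_cont_differentiable (Suc k) f \<longleftrightarrow>
     (\<forall>x. f differentiable (at x)) \<and>
     (\<forall>v. times_cont_differentiable k (\<lambda>x. frechet_derivative f (at x) v))"

definition smooth :: "('a::euclidean_space \<Rightarrow> real) \<Rightarrow> bool" where
  "smooth f \<longleftrightarrow> (\<forall>k. times_cont_differentiable k f)"

text \<open>The inequalities on \<open>fourier f\<close> use the order of \<open>Complex_Order\<close>, so they include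
  that the values are real (which is automatic for radial \<open>f\<close>).\<close>

definition cohn_elkies_feasible :: "real \<Rightarrow> ('a::euclidean_space \<Rightarrow> real) set" where
  "cohn_elkies_feasible r =
     {f. radial f \<and> smooth f \<and> rapidly_decreasing f \<and>
         f 0 > 0 \<and> fourier f 0 \<ge> 1 \<and>
         (\<forall>x. norm x \<ge> r \<longrightarrow> f x \<le> 0) \<and>
         (\<forall>y. fourier f y \<ge> 0)}"

text \<open>The infimum is taken in the extended reals, where it is always meaningful.\<close>

definition cohn_elkies_bound :: "'a::euclidean_space itself \<Rightarrow> real \<Rightarrow> ereal" where
  "cohn_elkies_bound _ r =
     (INF f\<in>(cohn_elkies_feasible r :: ('a \<Rightarrow> real) set). ereal ((r / 2) ^ DIM('a) * f 0))"

end

theory Submission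
  imports Defs "HOL-Real_Asymp.Real_Asymp"
begin

text \<open>A lower bound for the linear program comes from a summation formula with positive
coefficients on both sides. Here the formula is obtained from a weighted binary code, by
construction A. For a set \<open>S\<close> of coordinates of \<open>\<real>\<^sup>n\<close>, let \<open>v\<^sub>S\<close> be the vector with entries \<open>1/2\<close> on
\<open>S\<close> and \<open>0\<close> elsewhere, and give every point of the coset \<open>\<int>\<^sup>n + v\<^sub>S\<close> a weight \<open>w S \<ge> 0\<close>. Summing
the Poisson formulas of these cosets gives, for a sufficiently nice function \<open>f\<close>,

\<open>\<Sum>\<^sub>S w S \<Sum>\<^sub>p f(p) = \<Sum>\<^sub>m W(m) f^(m)\<close>, where \<open>p \<in> \<int>\<^sup>n + v\<^sub>S\<close>, \<open>m \<in> \<int>\<^sup>n\<close>,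
\<open>W(m) = \<Sum>\<^sub>S w S (-1)\<^bsup>|S \<inter> T|\<^esup>\<close>

and \<open>T\<close> is the set of the coordinates at which \<open>m\<close> is odd. Suppose that \<open>w {} = 1\<close>, that \<open>w S = 0\<close> for
\<open>0 < |S| < 4\<close>, and that \<open>W \<ge> 0\<close>. Then all points of positive weight other than the origin have norm at least
\<open>1\<close>, so for \<open>f\<close> feasible with \<open>r = 1\<close> the left side is at most \<open>f(0)\<close>, while the right side is at
least its term \<open>m = 0\<close>, which is \<open>(\<Sum>\<^sub>S w S) f^(0)\<close>. Hence the linear programming bound is at least
\<open>2\<^bsup>-n\<^esup> \<Sum>\<^sub>S w S\<close> (\<open>cohn_elkies_bound_ge_delsarte_weights\<close>): every feasible point of the
Delsarte linear program, which bounds the size of binary codes of length \<open>n\<close> and minimum distance \<open>4\<close> from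
above, bounds the Cohn-Elkies program from below.

In dimension \<open>12\<close> there are weights, depending on \<open>|S|\<close> only, with total \<open>512/3\<close>
(\<open>extremal_weight_transform\<close>), and \<open>(512/3) / 2\<^sup>1\<^sup>2 = 1/24\<close>. The theta series of the weighted point
set is a modular form of weight \<open>6\<close>. Since it is a polynomial in the theta constants \<open>\<theta>\<^sub>2\<close> and
\<open>\<theta>\<^sub>3\<close>, its expansion and its transformation behaviour reduce to counting signs in finite sets.

The Poisson formula itself would require some control of \<open>f^\<close>. Only the inequality between \<open>f(0)\<close>
and the term \<open>m = 0\<close> matters, and for that the point masses are replaced by Fejer kernels. These are
nonnegative trigonometric polynomials with nonnegative coefficients, so that integrating \<open>f\<close>
against them gives a finite positive combination of values of \<open>f^\<close>
(\<open>weighted_transform_le_integral\<close>). In the limit only the values of the positive part of \<open>f\<close> at the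
points of the configuration remain, and among these the value at the origin is the only nonzero one
(\<open>delsarte_weights_bound\<close>).\<close>

section \<open>The Fejer kernel on the line\<close>

definition fejer :: "nat \<Rightarrow> real \<Rightarrow> real" where
  "fejer N t = (cmod (\<Sum>k<N. cis (2 * pi * real k * t)))\<^sup>2 / real N"

lemma fejer_nonneg: "fejer N t \<ge> 0"
  by (simp add: fejer_def)

lemma continuous_on_fejer [continuous_intros]:
  "continuous_on A f \<Longrightarrow> continuous_on A (\<lambda>x. fejer N (f x))"
  unfolding fejer_def cis_conv_exp divide_inverse by (intro continuous_intros)

text \<open>All coefficients are positive, and the constant term comes from the \<open>N\<close> diagonal pairs \<open>(j, j)\<close>. The
pairs are kept separate instead of being grouped by their difference, since only the
contribution of the diagonal is ever singled out.\<close>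

lemma fejer_expansion:
  "complex_of_real (fejer N t) =
     (\<Sum>(j,l)\<in>{..<N}\<times>{..<N}. cis (2 * pi * (real j - real l) * t) / of_nat N)"
proof -
  have "complex_of_real ((cmod (\<Sum>k<N. cis (2 * pi * real k * t)))\<^sup>2) =
     (\<Sum>j<N. cis (2 * pi * real j * t)) * (\<Sum>l<N. cis (- (2 * pi * real l * t)))"
    unfolding complex_norm_square by (simp add: cis_cnj)
  also have "\<dots> = (\<Sum>j<N. \<Sum>l<N. cis (2 * pi * (real j - real l) * t))"
    unfolding sum_product by (simp add: cis_mult algebra_simps)
  finally show ?thesis
    unfolding fejer_def by (simp add: sum.cartesian_product sum_divide_distrib split_def)
qed

lemma fejer_cos_expansion:
  "fejer N t = (\<Sum>j<N. \<Sum>l<N. cos (2 * pi * of_int (int j - int l) * t)) / real N"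
proof -
  have "fejer N t = Re (complex_of_real (fejer N t))" by simp
  also have "\<dots> = (\<Sum>j<N. \<Sum>l<N. cos (2 * pi * of_int (int j - int l) * t) / real N)"
    unfolding fejer_expansion
    by (simp add: sum.cartesian_product split_def)
  finally show ?thesis by (simp add: sum_divide_distrib)
qed

lemma fejer_periodic: "fejer N (t + of_int m) = fejer N t"
proof -
  have "cos (2 * pi * of_int a * (t + of_int m)) = cos (2 * pi * of_int a * t)" for a
  proof -
    have "2 * pi * of_int a * (t + of_int m) = 2 * pi * of_int a * t + 2 * pi * of_int (a * m)"
      by (simp add: algebra_simps)
    then show ?thesis
      by (simp only: cos_add [of "2 * pi * of_int a * t"] cos_int_2pin sin_int_2pin)
  qed
  then show ?thesis unfolding fejer_cos_expansion by presburger
qed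

lemma has_integral_cos_period:
  "((\<lambda>t. cos (2 * pi * of_int m * t)) has_integral (if m = 0 then 1 else 0)) {-1/2..1/2}"
proof (cases "m = 0")
  case True
  then show ?thesis using has_integral_const_real[of "1::real" "-1/2" "1/2"] by simp
next
  case False
  have "((\<lambda>t. cos (2 * pi * of_int m * t)) has_integral
      (sin (2 * pi * of_int m * (1/2)) / (2 * pi * of_int m)
        - sin (2 * pi * of_int m * (-1/2)) / (2 * pi * of_int m))) {-1/2..1/2}"
    by (rule fundamental_theorem_of_calculus)
       (use False in \<open>auto simp: has_real_derivative_iff_has_vector_derivative [symmetric]
          intro!: derivative_eq_intros\<close>)
  moreover have "sin (pi * of_int m) = 0" by simp
  ultimately show ?thesis using False by simp
qed

lemma has_integral_fejer:
  assumes "N > 0"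
  shows "(fejer N has_integral 1) {-1/2..1/2}"
proof -
  have "(fejer N has_integral
      (\<Sum>j<N. \<Sum>l<N. if int j - int l = 0 then 1 else 0) / real N) {-1/2..1/2}"
    unfolding fejer_cos_expansion [abs_def]
    by (intro has_integral_divide has_integral_sum has_integral_cos_period) auto
  also have "(\<Sum>j<N. \<Sum>l<N. if int j - int l = 0 then 1 else (0::real)) = real N"
    by (simp)
  finally show ?thesis using assms by simp
qed

text \<open>This second moment measures the concentration of the kernel at the integers. It is elementary because
\<open>sin\<^sup>2(\<pi>t) = (1 - cos(2\<pi>t)) / 2\<close>, and among the \<open>N\<^sup>2\<close> pairs of frequencies exactly \<open>N - 1\<close> have
difference \<open>1\<close>, and \<open>N - 1\<close> have difference \<open>-1\<close>.\<close>

lemma has_integral_fejer_sin_squared: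
  assumes "N > 0"
  shows "((\<lambda>t. fejer N t * (sin (pi * t))\<^sup>2) has_integral 1 / (2 * real N)) {-1/2..1/2}"
proof -
  have eq: "fejer N t * (sin (pi * t))\<^sup>2 =
      (fejer N t - (\<Sum>j<N. \<Sum>l<N. (cos (2 * pi * of_int (int j - int l - 1) * t)
         + cos (2 * pi * of_int (int j - int l + 1) * t)) / 2) / real N) / 2" for t
  proof -
    have "(sin (pi * t))\<^sup>2 = (1 - cos (2 * pi * t)) / 2"
      using cos_double_sin [of "pi * t"] by (simp add: algebra_simps)
    moreover have "fejer N t * cos (2 * pi * t) =
      (\<Sum>j<N. \<Sum>l<N. (cos (2 * pi * of_int (int j - int l - 1) * t)
         + cos (2 * pi * of_int (int j - int l + 1) * t)) / 2) / real N"
    proof -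
      have "cos (2 * pi * of_int a * t) * cos (2 * pi * t) =
          (cos (2 * pi * of_int (a - 1) * t) + cos (2 * pi * of_int (a + 1) * t)) / 2" for a
        unfolding cos_times_cos by (simp add: algebra_simps)
      then show ?thesis
        unfolding fejer_cos_expansion times_divide_eq_left sum_distrib_right
        by (simp only:)
    qed
    ultimately show ?thesis by (simp only: right_diff_distrib times_divide_eq_right mult_1_right)
  qed
  have "((\<lambda>t. fejer N t * (sin (pi * t))\<^sup>2) has_integral
      (1 - (\<Sum>j<N. \<Sum>l<N. ((if int j - int l - 1 = 0 then 1 else 0)
         + (if int j - int l + 1 = 0 then 1 else 0)) / 2) / real N) / 2) {-1/2..1/2}"
    unfolding eq
    by (intro has_integral_divide has_integral_diff has_integral_sum has_integral_add
         has_integral_cos_period has_integral_fejer assms) auto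
  also have "(\<Sum>j<N. \<Sum>l<N. ((if int j - int l - 1 = 0 then 1 else 0)
         + (if int j - int l + 1 = 0 then 1 else (0::real))) / 2) = real N - 1"
    using assms
  proof (induction N)
    case (Suc N)
    show ?case
    proof (cases "N = 0")
      case False
      have "(\<Sum>l<N. ((if int N - int l - 1 = 0 then 1 else 0)
         + (if int N - int l + 1 = 0 then 1 else (0::real))) / 2)
         = (\<Sum>l<N. if l = N - 1 then 1/2 else 0)"
        by (intro sum.cong) auto
      also have "\<dots> = 1/2" using False by simp
      finally have a: "(\<Sum>l<N. ((if int N - int l - 1 = 0 then 1 else 0)
         + (if int N - int l + 1 = 0 then 1 else (0::real))) / 2) = 1/2" .
      have "(\<Sum>j<N. ((if int j - int N - 1 = 0 then 1 else 0)
         + (if int j - int N + 1 = 0 then 1 else (0::real))) / 2)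
         = (\<Sum>j<N. if j = N - 1 then 1/2 else 0)"
        by (intro sum.cong) auto
      also have "\<dots> = 1/2" using False by simp
      finally have b: "(\<Sum>j<N. ((if int j - int N - 1 = 0 then 1 else 0)
         + (if int j - int N + 1 = 0 then 1 else (0::real))) / 2) = 1/2" .
      show ?thesis using Suc.IH False
        by (simp only: sum.lessThan_Suc sum.distrib a b) simp
    qed simp
  qed simp
  finally show ?thesis using assms by (simp add: field_simps)
qed

section \<open>The product kernel is an approximate identity on a unit cell\<close>

definition fejer_kernel :: "nat \<Rightarrow> 'a::euclidean_space \<Rightarrow> real" where
  "fejer_kernel N x = (\<Prod>b\<in>Basis. fejer N (x \<bullet> b))"

definition unit_cell :: "'a::euclidean_space set" where
  "unit_cell = {x. \<forall>b\<in>Basis. - 1 / 2 \<le> x \<bullet> b \<and> x \<bullet> b \<le> 1 / 2}"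

lemma mem_unit_cell:
  "x \<in> unit_cell \<longleftrightarrow> (\<forall>b\<in>Basis. - 1 / 2 \<le> x \<bullet> b \<and> x \<bullet> b \<le> 1 / 2)"
  by (simp add: unit_cell_def)

lemma compact_unit_cell: "compact (unit_cell :: 'a::euclidean_space set)"
proof -
  have "(unit_cell :: 'a set) = cbox (- (1/2) *\<^sub>R One) ((1/2) *\<^sub>R One)"
    by (auto simp: mem_unit_cell mem_box)
  then show ?thesis by (metis compact_cbox)
qed

lemma measurable_unit_cell [measurable]: "(unit_cell :: 'a::euclidean_space set) \<in> sets borel"
  by (intro borel_closed compact_imp_closed compact_unit_cell)

lemma fejer_kernel_nonneg: "fejer_kernel N x \<ge> 0"
  by (simp add: fejer_kernel_def fejer_nonneg prod_nonneg)

lemma continuous_on_fejer_kernel [continuous_intros]: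
  "continuous_on A f \<Longrightarrow> continuous_on A (\<lambda>x. fejer_kernel N (f x))"
  unfolding fejer_kernel_def by (intro continuous_intros)

lemma borel_measurable_fejer [measurable]: "fejer N \<in> borel_measurable borel"
  by (intro borel_measurable_continuous_onI continuous_intros)

lemma fejer_kernel_periodic:
  assumes "\<And>b. b \<in> Basis \<Longrightarrow> z \<bullet> b \<in> \<int>"
  shows "fejer_kernel N (x + z) = fejer_kernel N x"
  unfolding fejer_kernel_def
proof (rule prod.cong)
  fix b :: 'a assume "b \<in> Basis"
  then obtain m where "z \<bullet> b = of_int m" using assms by (blast elim: Ints_cases)
  then show "fejer N ((x + z) \<bullet> b) = fejer N (x \<bullet> b)"
    by (simp add: inner_add_left fejer_periodic)
qed simp

text \<open>Fubini, in the form needed for the moments of the product kernel.\<close>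

lemma set_integral_unit_cell_prod:
  fixes u :: "'a::euclidean_space \<Rightarrow> real \<Rightarrow> real"
  assumes meas: "\<And>b. b \<in> Basis \<Longrightarrow> u b \<in> borel_measurable borel"
    and nonneg: "\<And>b t. b \<in> Basis \<Longrightarrow> u b t \<ge> 0"
    and int: "\<And>b. b \<in> Basis \<Longrightarrow> (u b has_integral I b) {-1/2..1/2}"
  shows "(LINT x:unit_cell|lborel. \<Prod>b\<in>Basis. u b (x \<bullet> b)) = (\<Prod>b\<in>Basis. I b)"
proof -
  have I: "I b \<ge> 0" if "b \<in> Basis" for b
    using has_integral_nonneg [OF int [OF that]] nonneg that by blast
  have ind: "indicator unit_cell x * (\<Prod>b\<in>Basis. u b (x \<bullet> b)) =
      (\<Prod>b\<in>Basis. indicator {-1/2..1/2} (x \<bullet> b) * u b (x \<bullet> b))" for x :: 'a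
  proof (cases "x \<in> unit_cell")
    case True
    then show ?thesis by (simp add: mem_unit_cell indicator_def)
  next
    case False
    then obtain b where "b \<in> Basis" "x \<bullet> b \<notin> {-1/2..1/2}"
      unfolding mem_unit_cell by auto
    then have "(\<Prod>b\<in>Basis. indicator {-1/2..1/2} (x \<bullet> b) * u b (x \<bullet> b)) = 0"
      by (intro prod_zero) (auto simp: indicator_def)
    then show ?thesis using False by simp
  qed
  have "(\<integral>\<^sup>+x. ennreal (\<Prod>b\<in>Basis. indicator {-1/2..1/2} (x \<bullet> b) * u b (x \<bullet> b)) \<partial>lborel)
      = (\<integral>\<^sup>+x. (\<Prod>b\<in>Basis. ennreal (indicator {-1/2..1/2} (x \<bullet> b) * u b (x \<bullet> b))) \<partial>lborel)"
    by (intro nn_integral_cong prod_ennreal [symmetric]) (simp add: nonneg)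
  also have "\<dots> = (\<Prod>b\<in>Basis. \<integral>\<^sup>+t. ennreal (indicator {-1/2..1/2} t * u b t) \<partial>lborel)"
    by (rule nn_integral_lborel_prod) (use meas in auto)
  also have "\<dots> = (\<Prod>b\<in>Basis. ennreal (I b))"
  proof (rule prod.cong)
    fix b :: 'a assume "b \<in> Basis"
    then show "(\<integral>\<^sup>+t. ennreal (indicator {-1/2..1/2} t * u b t) \<partial>lborel) = ennreal (I b)"
      using nn_integral_has_integral_lebesgue [OF nonneg int] by blast
  qed simp
  also have "\<dots> = ennreal (\<Prod>b\<in>Basis. I b)"
    by (rule prod_ennreal) (rule I)
  finally have "(\<integral>\<^sup>+x. ennreal (indicator unit_cell x * (\<Prod>b\<in>Basis. u b (x \<bullet> b))) \<partial>lborel)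
      = ennreal (\<Prod>b\<in>Basis. I b)"
    by (simp add: ind)
  moreover have "(\<lambda>x. indicator unit_cell x * (\<Prod>b\<in>Basis. u b (x \<bullet> b))) \<in> borel_measurable borel"
    using meas by measurable
  ultimately show ?thesis
    unfolding set_lebesgue_integral_def real_scaleR_def
    by (subst integral_eq_nn_integral) (auto simp: nonneg I prod_nonneg)
qed

lemma set_integral_fejer_kernel:
  assumes "N > 0"
  shows "(LINT x:(unit_cell::'a::euclidean_space set)|lborel. fejer_kernel N x) = 1"
  unfolding fejer_kernel_def
  using set_integral_unit_cell_prod [of "\<lambda>_::'a. fejer N" "\<lambda>_. 1"] assms
  by (simp add: fejer_nonneg has_integral_fejer [OF assms, simplified])

lemma set_integral_fejer_kernel_sin_squared:
  fixes c :: "'a::euclidean_space"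
  assumes "N > 0" "c \<in> Basis"
  shows "(LINT x:unit_cell|lborel. fejer_kernel N x * (sin (pi * (x \<bullet> c)))\<^sup>2) = 1 / (2 * real N)"
proof -
  define u where "u b t = fejer N t * (if b = c then (sin (pi * t))\<^sup>2 else 1)" for b :: 'a and t
  have "fejer_kernel N x * (sin (pi * (x \<bullet> c)))\<^sup>2 = (\<Prod>b\<in>Basis. u b (x \<bullet> b))" for x
    unfolding u_def fejer_kernel_def prod.distrib using assms(2) by simp
  moreover have "(LINT x:unit_cell|lborel. \<Prod>b\<in>Basis. u b (x \<bullet> b))
      = (\<Prod>b\<in>Basis. if b = c then 1 / (2 * real N) else 1)"
  proof (rule set_integral_unit_cell_prod)
    fix b :: 'a
    show "u b \<in> borel_measurable borel"
      unfolding u_def by measurable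
    show "(u b has_integral (if b = c then 1 / (2 * real N) else 1)) {-1/2..1/2}"
      unfolding u_def [abs_def]
      using has_integral_fejer [OF assms(1)] has_integral_fejer_sin_squared [OF assms(1)] by simp
  qed (simp add: u_def fejer_nonneg)
  ultimately show ?thesis using assms(2) by simp
qed

text \<open>The test function \<open>\<Sum>\<^sub>b sin\<^sup>2(\<pi>x\<^sub>b)\<close> vanishes on the unit cell only at the origin. Near the origin
continuity gives the bound, and on the compact rest of the cell the quotient by the test
function is continuous, hence bounded. As in Korovkin's theorem, this reduces the convergence of
the kernels on all continuous functions to their second moments.\<close>

lemma korovkin_bound:
  fixes g :: "'a::euclidean_space \<Rightarrow> real"
  assumes cont: "continuous_on UNIV g" and "\<epsilon> > 0"
  obtains A where "A \<ge> 0"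
    "\<And>x. x \<in> unit_cell \<Longrightarrow> \<bar>g x - g 0\<bar> \<le> \<epsilon> + A * (\<Sum>b\<in>Basis. (sin (pi * (x \<bullet> b)))\<^sup>2)"
proof -
  define s :: "'a \<Rightarrow> real" where "s x = (\<Sum>b\<in>Basis. (sin (pi * (x \<bullet> b)))\<^sup>2)" for x
  obtain \<delta> where \<delta>: "\<delta> > 0" "\<And>x. dist x 0 < \<delta> \<Longrightarrow> dist (g x) (g 0) < \<epsilon>"
    using cont \<open>\<epsilon> > 0\<close> unfolding continuous_on_iff by (metis UNIV_I)
  define K :: "'a set" where "K = unit_cell - ball 0 \<delta>"
  have K: "compact K" unfolding K_def by (intro compact_diff compact_unit_cell) auto
  have s_pos: "s x > 0" if "x \<in> K" for x
  proof -
    have "x \<noteq> 0" using that \<delta>(1) by (auto simp: K_def)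
    then obtain b where b: "b \<in> Basis" "x \<bullet> b \<noteq> 0"
      using euclidean_all_zero_iff by blast
    have "- 1 / 2 \<le> x \<bullet> b" "x \<bullet> b \<le> 1 / 2"
      using that b(1) unfolding K_def by (auto simp: mem_unit_cell)
    then have "\<bar>pi * (x \<bullet> b)\<bar> < pi" "pi * (x \<bullet> b) \<noteq> 0"
      using b(2) by (auto simp: abs_mult)
    then have "sin (pi * (x \<bullet> b)) \<noteq> 0"
      using sin_zero_pi_iff by blast
    then show ?thesis unfolding s_def using b(1) by (intro sum_pos2 [of _ b]) auto
  qed
  have "continuous_on K (\<lambda>x. (g x - g 0) / s x)"
    using s_pos unfolding s_def
    by (intro continuous_intros continuous_on_subset [OF cont]) (auto simp: less_le)
  then have "bounded ((\<lambda>x. (g x - g 0) / s x) ` K)"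
    using K compact_continuous_image compact_imp_bounded by blast
  then obtain A where A: "A > 0" "\<And>x. x \<in> K \<Longrightarrow> \<bar>(g x - g 0) / s x\<bar> \<le> A"
    unfolding bounded_pos by auto
  show ?thesis
  proof (rule that [of A])
    show "A \<ge> 0" using A(1) by simp
    fix x :: 'a assume x: "x \<in> unit_cell"
    have "\<bar>g x - g 0\<bar> \<le> \<epsilon> + A * s x"
    proof (cases "dist x 0 < \<delta>")
      case True
      moreover have "s x \<ge> 0" unfolding s_def by (intro sum_nonneg) auto
      ultimately show ?thesis using \<delta>(2) [of x] A(1) by (simp add: dist_real_def add_increasing2)
    next
      case False
      then have "x \<in> K" using x by (simp add: K_def dist_commute)
      then show ?thesis using A(2) [of x] s_pos [of x] \<open>\<epsilon> > 0\<close> by (simp add: abs_divide field_simps)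
    qed
    then show "\<bar>g x - g 0\<bar> \<le> \<epsilon> + A * (\<Sum>b\<in>Basis. (sin (pi * (x \<bullet> b)))\<^sup>2)"
      by (simp add: s_def)
  qed
qed

lemma set_integrable_unit_cell:
  fixes h :: "'a::euclidean_space \<Rightarrow> real"
  assumes "continuous_on UNIV h"
  shows "set_integrable lborel unit_cell h"
  unfolding set_integrable_def
  by (rule borel_integrable_compact) (auto intro: continuous_on_subset [OF assms] compact_unit_cell)

lemma fejer_kernel_approximate_identity:
  fixes g :: "'a::euclidean_space \<Rightarrow> real"
  assumes cont: "continuous_on UNIV g"
  shows "(\<lambda>N. LINT x:unit_cell|lborel. g x * fejer_kernel N x) \<longlonglongrightarrow> g 0"
proof (rule LIMSEQ_I)
  fix e :: real assume "e > 0"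
  obtain A where A: "A \<ge> 0"
    "\<And>x. x \<in> unit_cell \<Longrightarrow> \<bar>g x - g 0\<bar> \<le> e / 2 + A * (\<Sum>b\<in>Basis. (sin (pi * (x \<bullet> b)))\<^sup>2)"
    using korovkin_bound [OF cont, of "e / 2"] \<open>e > 0\<close> by auto
  have bound: "\<bar>(LINT x:unit_cell|lborel. g x * fejer_kernel N x) - g 0\<bar>
      \<le> e / 2 + A * DIM('a) / (2 * real N)" if "N > 0" for N
  proof -
    let ?C = "unit_cell :: 'a set"
    have "(LINT x:?C|lborel. g x * fejer_kernel N x) - g 0
        = (LINT x:?C|lborel. g x * fejer_kernel N x)
          - (LINT x:?C|lborel. g 0 * fejer_kernel N x)"
      by (simp add: set_integral_fejer_kernel [OF that])
    also have "\<dots> = (LINT x:?C|lborel. g x * fejer_kernel N x - g 0 * fejer_kernel N x)"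
      by (rule set_integral_diff(2) [symmetric])
        (intro set_integrable_unit_cell continuous_intros cont)+
    also have "\<bar>\<dots>\<bar> \<le> (LINT x:?C|lborel. \<bar>g x * fejer_kernel N x - g 0 * fejer_kernel N x\<bar>)"
      unfolding real_norm_def [symmetric]
      by (rule set_integral_norm_bound) (intro set_integrable_unit_cell continuous_intros cont)
    also have "\<dots> \<le> (LINT x:?C|lborel. e / 2 * fejer_kernel N x
         + A * (\<Sum>b\<in>Basis. fejer_kernel N x * (sin (pi * (x \<bullet> b)))\<^sup>2))"
    proof (rule set_integral_mono)
      fix x :: 'a assume "x \<in> unit_cell"
      have "\<bar>g x * fejer_kernel N x - g 0 * fejer_kernel N x\<bar> = \<bar>g x - g 0\<bar> * fejer_kernel N x"
        by (simp add: left_diff_distrib [symmetric] abs_mult fejer_kernel_nonneg)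
      also have "\<dots> \<le> (e / 2 + A * (\<Sum>b\<in>Basis. (sin (pi * (x \<bullet> b)))\<^sup>2)) * fejer_kernel N x"
        by (rule mult_right_mono [OF A(2) [OF \<open>x \<in> unit_cell\<close>] fejer_kernel_nonneg])
      finally show "\<bar>g x * fejer_kernel N x - g 0 * fejer_kernel N x\<bar> \<le> e / 2 * fejer_kernel N x
         + A * (\<Sum>b\<in>Basis. fejer_kernel N x * (sin (pi * (x \<bullet> b)))\<^sup>2)"
        by (simp add: sum_distrib_left sum_distrib_right algebra_simps)
    qed (intro set_integrable_unit_cell continuous_intros cont)+
    also have "\<dots> = (LINT x:?C|lborel. e / 2 * fejer_kernel N x)
         + (LINT x:?C|lborel. A * (\<Sum>b\<in>Basis. fejer_kernel N x * (sin (pi * (x \<bullet> b)))\<^sup>2))"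
      by (rule set_integral_add) (intro set_integrable_unit_cell continuous_intros)+
    also have "(LINT x:?C|lborel. A * (\<Sum>b\<in>Basis. fejer_kernel N x * (sin (pi * (x \<bullet> b)))\<^sup>2))
        = A * (\<Sum>b\<in>(Basis::'a set). LINT x:?C|lborel. fejer_kernel N x * (sin (pi * (x \<bullet> b)))\<^sup>2)"
      unfolding set_integral_mult_right
      unfolding set_lebesgue_integral_def scaleR_sum_right
      by (subst Bochner_Integration.integral_sum)
         (auto simp del: real_scaleR_def simp flip: set_integrable_def
            intro!: set_integrable_unit_cell continuous_intros)
    finally show ?thesis
      using that by (simp add: set_integral_fejer_kernel set_integral_fejer_kernel_sin_squared)
  qed
  have "(\<lambda>N. A * DIM('a) / (2 * real N)) \<longlonglongrightarrow> 0"
    by real_asymp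
  then obtain M where M: "\<And>N. N \<ge> M \<Longrightarrow> A * DIM('a) / (2 * real N) < e / 2"
    using \<open>e > 0\<close> unfolding LIMSEQ_def dist_real_def
    by (metis abs_ge_self diff_zero half_gt_zero le_less_trans)
  show "\<exists>M. \<forall>N\<ge>M. norm ((LINT x:unit_cell|lborel. g x * fejer_kernel N x) - g 0) < e"
  proof (intro exI allI impI)
    fix N assume "N \<ge> max M 1"
    then show "norm ((LINT x:unit_cell|lborel. g x * fejer_kernel N x) - g 0) < e"
      using M [of N] bound [of N] by simp
  qed
qed

section \<open>The Fourier side\<close>

definition half_sum :: "'a::euclidean_space set \<Rightarrow> 'a" where
  "half_sum S = (1/2) *\<^sub>R \<Sum>S"

definition smoothed_weights :: "('a::euclidean_space set \<Rightarrow> real) \<Rightarrow> nat \<Rightarrow> 'a \<Rightarrow> real" where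
  "smoothed_weights w N x = (\<Sum>S\<in>Pow Basis. w S * fejer_kernel N (x - half_sum S))"

lemma prod_cis: "(\<Prod>b\<in>A. cis (\<theta> b)) = cis (\<Sum>b\<in>A. \<theta> b)"
  by (induction A rule: infinite_finite_induct) (auto simp: cis_mult)

text \<open>A function \<open>h\<close> chooses a pair \<open>(j, l)\<close> in the expansion of the one-dimensional kernel for each
coordinate; \<open>freq h\<close> is the resulting integer frequency vector, with entries \<open>j - l\<close>.\<close>

definition freq :: "('a::euclidean_space \<Rightarrow> nat \<times> nat) \<Rightarrow> 'a" where
  "freq h = (\<Sum>b\<in>Basis. (real (fst (h b)) - real (snd (h b))) *\<^sub>R b)"

definition odd_support :: "('a::euclidean_space \<Rightarrow> nat \<times> nat) \<Rightarrow> 'a set" where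
  "odd_support h = {b\<in>Basis. odd (int (fst (h b)) - int (snd (h b)))}"

lemma inner_freq_Basis:
  "b \<in> Basis \<Longrightarrow> freq h \<bullet> b = of_int (int (fst (h b)) - int (snd (h b)))"
  by (simp add: freq_def)

lemma fejer_kernel_expansion:
  fixes x :: "'a::euclidean_space"
  shows "complex_of_real (fejer_kernel N x) =
    (\<Sum>h\<in>Basis \<rightarrow>\<^sub>E {..<N} \<times> {..<N}. cis (2 * pi * (freq h \<bullet> x))) / of_nat N ^ DIM('a)"
proof -
  have "complex_of_real (fejer_kernel N x) =
     (\<Prod>b\<in>Basis. \<Sum>p\<in>{..<N}\<times>{..<N}. cis (2 * pi * (real (fst p) - real (snd p)) * (x \<bullet> b)) / of_nat N)"
    unfolding fejer_kernel_def of_real_prod fejer_expansion by (simp add: split_def)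
  also have "\<dots> = (\<Sum>h\<in>Basis \<rightarrow>\<^sub>E {..<N} \<times> {..<N}.
      \<Prod>b\<in>Basis. cis (2 * pi * (real (fst (h b)) - real (snd (h b))) * (x \<bullet> b)) / of_nat N)"
    by (rule prod_sum_PiE) auto
  also have "\<dots> = (\<Sum>h\<in>Basis \<rightarrow>\<^sub>E {..<N} \<times> {..<N}. cis (2 * pi * (freq h \<bullet> x)) / of_nat N ^ DIM('a))"
  proof (rule sum.cong)
    fix h :: "'a \<Rightarrow> nat \<times> nat"
    have "freq h \<bullet> x = (\<Sum>b\<in>Basis. (real (fst (h b)) - real (snd (h b))) * (x \<bullet> b))"
      unfolding freq_def inner_sum_left inner_scaleR_left by (simp add: inner_commute)
    then show "(\<Prod>b\<in>Basis. cis (2 * pi * (real (fst (h b)) - real (snd (h b))) * (x \<bullet> b)) / of_nat N)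
        = cis (2 * pi * (freq h \<bullet> x)) / of_nat N ^ DIM('a)"
      by (simp add: prod_dividef prod_cis sum_distrib_left mult.assoc)
  qed simp
  finally show ?thesis by (simp add: sum_divide_distrib)
qed

text \<open>A character of \<open>\<real>\<^sup>n/\<int>\<^sup>n\<close> takes the values \<open>1\<close> and \<open>-1\<close> at half-integral points, and there it depends
only on the parities of its frequencies. This is how the transform of the weights becomes a
transform on the subsets of the coordinates.\<close>

lemma character_at_half_sum:
  fixes S :: "'a::euclidean_space set"
  assumes "S \<subseteq> Basis"
  shows "cis (2 * pi * (freq h \<bullet> half_sum S)) = (-1) ^ card (S \<inter> odd_support h)"
proof -
  have fin: "finite S" using assms finite_Basis by (rule finite_subset)
  have "2 * pi * (freq h \<bullet> half_sum S) = (\<Sum>b\<in>S. pi * (freq h \<bullet> b))"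
    by (simp add: half_sum_def inner_sum_right sum_distrib_left)
  also have "cis \<dots> = (\<Prod>b\<in>S. cis (pi * (freq h \<bullet> b)))"
    by (simp only: prod_cis)
  also have "\<dots> = (\<Prod>b\<in>S. if b \<in> odd_support h then -1 else 1)"
  proof (rule prod.cong)
    fix b assume "b \<in> S"
    then have "b \<in> Basis" using assms by auto
    then show "cis (pi * (freq h \<bullet> b)) = (if b \<in> odd_support h then -1 else 1)"
      unfolding inner_freq_Basis [OF \<open>b \<in> Basis\<close>]
      by (simp add: complex_eq_iff odd_support_def del: of_int_diff of_int_of_nat_eq)
  qed simp
  also have "\<dots> = (\<Prod>b\<in>S \<inter> odd_support h. -1)"
    by (rule prod.inter_restrict [OF fin, symmetric])
  finally show ?thesis by simp
qed

lemma smoothed_weights_expansion: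
  fixes x :: "'a::euclidean_space"
  shows "complex_of_real (smoothed_weights w N x) =
    (\<Sum>h\<in>Basis \<rightarrow>\<^sub>E {..<N} \<times> {..<N}.
       of_real (\<Sum>S\<in>Pow Basis. w S * (-1) ^ card (S \<inter> odd_support h)) * cis (2 * pi * (freq h \<bullet> x)))
    / of_nat N ^ DIM('a)"
proof -
  have character: "cis (2 * pi * (freq h \<bullet> (x - half_sum S)))
      = (-1) ^ card (S \<inter> odd_support h) * cis (2 * pi * (freq h \<bullet> x))" if "S \<in> Pow Basis" for h S
  proof -
    have "cis (2 * pi * (freq h \<bullet> (x - half_sum S)))
        = cis (2 * pi * (freq h \<bullet> x)) / cis (2 * pi * (freq h \<bullet> half_sum S))"
      by (simp add: cis_divide inner_diff_right right_diff_distrib)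
    then show ?thesis
      using that by (cases "even (card (S \<inter> odd_support h))") (simp_all add: character_at_half_sum)
  qed
  have "complex_of_real (smoothed_weights w N x)
     = (\<Sum>S\<in>Pow Basis. of_real (w S) * ((\<Sum>h\<in>Basis \<rightarrow>\<^sub>E {..<N} \<times> {..<N}.
        (-1) ^ card (S \<inter> odd_support h) * cis (2 * pi * (freq h \<bullet> x))) / of_nat N ^ DIM('a)))"
    unfolding smoothed_weights_def of_real_sum of_real_mult fejer_kernel_expansion
    by (intro sum.cong refl arg_cong2 [of _ _ _ _ "(*)"] arg_cong2 [of _ _ _ _ "(/)"] character) auto
  also have "\<dots> = (\<Sum>S\<in>Pow Basis. \<Sum>h\<in>Basis \<rightarrow>\<^sub>E {..<N} \<times> {..<N}.
        of_real (w S * (-1) ^ card (S \<inter> odd_support h)) * cis (2 * pi * (freq h \<bullet> x)) / of_nat N ^ DIM('a))"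
    by (simp add: sum_distrib_left sum_divide_distrib mult.assoc)
  also have "\<dots> = (\<Sum>h\<in>Basis \<rightarrow>\<^sub>E {..<N} \<times> {..<N}. \<Sum>S\<in>Pow Basis.
        of_real (w S * (-1) ^ card (S \<inter> odd_support h)) * cis (2 * pi * (freq h \<bullet> x)) / of_nat N ^ DIM('a))"
    by (rule sum.swap)
  also have "\<dots> = (\<Sum>h\<in>Basis \<rightarrow>\<^sub>E {..<N} \<times> {..<N}.
       of_real (\<Sum>S\<in>Pow Basis. w S * (-1) ^ card (S \<inter> odd_support h)) * cis (2 * pi * (freq h \<bullet> x)))
    / of_nat N ^ DIM('a)"
    by (simp only: sum_divide_distrib of_real_sum sum_distrib_right)
  finally show ?thesis .
qed

lemma integral_times_character:
  fixes f :: "'a::euclidean_space \<Rightarrow> real"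
  shows "(LINT x|lborel. of_real (f x) * cis (2 * pi * (\<mu> \<bullet> x))) = fourier f (- \<mu>)"
  unfolding fourier_def
  by (intro Bochner_Integration.integral_cong) (auto simp: cis_conv_exp inner_commute mult_ac)

lemma integrable_times_character:
  fixes f :: "'a::euclidean_space \<Rightarrow> real"
  assumes "integrable lborel f"
  shows "integrable lborel (\<lambda>x. of_real (f x) * cis (2 * pi * (\<mu> \<bullet> x)))"
proof (rule Bochner_Integration.integrable_bound [OF assms])
  have [measurable]: "f \<in> borel_measurable borel" using assms by simp
  have [measurable]: "(\<lambda>x. cis (2 * pi * (\<mu> \<bullet> x))) \<in> borel_measurable borel"
    by (intro borel_measurable_continuous_onI) (auto simp: cis_conv_exp intro!: continuous_intros)
  show "(\<lambda>x. of_real (f x) * cis (2 * pi * (\<mu> \<bullet> x))) \<in> borel_measurable lborel"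
    by measurable
qed (simp add: norm_mult)

text \<open>The smoothed form of the right side of the summation formula. All terms of the expansion contribute
a nonnegative value of the Fourier transform with a nonnegative coefficient. The choices with
\<open>j = l\<close> in every coordinate have frequency \<open>0\<close>, and there are \<open>N\<^sup>n\<close> of them, which cancels the
normalization exactly; so dropping all other terms leaves the full value at \<open>0\<close> for every \<open>N\<close>.\<close>

lemma weighted_transform_le_integral:
  fixes f :: "'a::euclidean_space \<Rightarrow> real"
  assumes int: "integrable lborel f"
    and fourier: "\<And>y. fourier f y \<ge> 0"
    and spectrum: "\<And>T. T \<subseteq> Basis \<Longrightarrow> (\<Sum>S\<in>Pow Basis. w S * (-1) ^ card (S \<inter> T)) \<ge> 0"
    and "N > 0"
  shows "(\<Sum>S\<in>Pow Basis. w S) * Re (fourier f 0) \<le> (LINT x|lborel. f x * smoothed_weights w N x)"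
proof -
  define \<sigma> where "\<sigma> h = (\<Sum>S\<in>Pow Basis. w S * (-1) ^ card (S \<inter> odd_support h))"
    for h :: "'a \<Rightarrow> nat \<times> nat"
  define H where "H = (Basis :: 'a set) \<rightarrow>\<^sub>E {..<N} \<times> {..<N}"
  define D where "D = (Basis :: 'a set) \<rightarrow>\<^sub>E (\<lambda>k. (k, k)) ` {..<N}"
  have "complex_of_real (LINT x|lborel. f x * smoothed_weights w N x)
      = (LINT x|lborel. complex_of_real (f x * smoothed_weights w N x))"
    by (rule integral_complex_of_real [symmetric])
  also have "\<dots> = (LINT x|lborel. (\<Sum>h\<in>H. of_real (\<sigma> h) * (of_real (f x) * cis (2 * pi * (freq h \<bullet> x))))
        / of_nat N ^ DIM('a))"
    unfolding of_real_mult smoothed_weights_expansion H_def \<sigma>_def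
    by (simp add: sum_distrib_left sum_divide_distrib mult_ac)
  also have "\<dots> = (\<Sum>h\<in>H. of_real (\<sigma> h) * fourier f (- freq h)) / of_nat N ^ DIM('a)"
    by (simp add: integral_sum integrable_times_character int integral_times_character)
  finally have "(LINT x|lborel. f x * smoothed_weights w N x)
      = Re ((\<Sum>h\<in>H. of_real (\<sigma> h) * fourier f (- freq h)) / of_nat N ^ DIM('a))"
    by (metis Re_complex_of_real)
  also have "\<dots> = (\<Sum>h\<in>H. \<sigma> h * Re (fourier f (- freq h))) / real N ^ DIM('a)"
    by (simp flip: of_nat_power)
  finally have integral: "(LINT x|lborel. f x * smoothed_weights w N x)
      = (\<Sum>h\<in>H. \<sigma> h * Re (fourier f (- freq h))) / real N ^ DIM('a)" .
  have diagonal: "freq h = 0 \<and> odd_support h = {}" if "h \<in> D" for h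
  proof -
    have "fst (h b) = snd (h b)" if "b \<in> Basis" for b
      using \<open>h \<in> D\<close> that by (auto simp: D_def PiE_iff)
    then show ?thesis by (simp add: freq_def odd_support_def)
  qed
  have "card D = N ^ DIM('a)"
    unfolding D_def by (simp add: card_PiE card_image inj_on_def)
  then have "(\<Sum>h\<in>D. \<sigma> h * Re (fourier f (- freq h)))
      = real N ^ DIM('a) * ((\<Sum>S\<in>Pow Basis. w S) * Re (fourier f 0))"
    by (simp add: diagonal \<sigma>_def)
  moreover have "(\<Sum>h\<in>D. \<sigma> h * Re (fourier f (- freq h))) \<le> (\<Sum>h\<in>H. \<sigma> h * Re (fourier f (- freq h)))"
  proof (rule sum_mono2)
    show "finite H" unfolding H_def by (intro finite_PiE) auto
    show "D \<subseteq> H" unfolding D_def H_def by (intro PiE_mono) auto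
    fix h :: "'a \<Rightarrow> nat \<times> nat"
    have "\<sigma> h \<ge> 0" unfolding \<sigma>_def by (intro spectrum) (auto simp: odd_support_def)
    moreover have "Re (fourier f (- freq h)) \<ge> 0"
      using fourier [of "- freq h"] by (simp add: less_eq_complex_def)
    ultimately show "0 \<le> \<sigma> h * Re (fourier f (- freq h))" by simp
  qed
  ultimately show ?thesis
    unfolding integral using \<open>N > 0\<close> by (simp add: pos_le_divide_eq mult.commute)
qed

section \<open>The configuration side\<close>

lemma lborel_translation:
  fixes G :: "'a::euclidean_space \<Rightarrow> real"
  assumes "integrable lborel G"
  shows "integrable lborel (\<lambda>x. G (x - p))"
    and "(LINT x|lborel. G (x - p)) = (LINT x|lborel. G x)"
proof -
  have G: "G \<in> borel_measurable borel" using assms by simp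
  have T: "(+) (- p) \<in> measurable lborel borel" by measurable
  have "integrable (distr lborel borel ((+) (- p))) G"
    unfolding lborel_distr_plus by (rule assms)
  then show "integrable lborel (\<lambda>x. G (x - p))"
    unfolding integrable_distr_eq [OF T G] by simp
  show "(LINT x|lborel. G (x - p)) = (LINT x|lborel. G x)"
    using integral_distr [OF T G] unfolding lborel_distr_plus by simp
qed

definition translate :: "('a::euclidean_space \<Rightarrow> real) \<Rightarrow> 'a" where
  "translate e = (\<Sum>b\<in>Basis. e b *\<^sub>R b)"

text \<open>The entries \<open>-1\<close>, \<open>0\<close>, \<open>1\<close> suffice: as the entries of \<open>half_sum S\<close> are \<open>0\<close> or \<open>1/2\<close>, the unit cells
around the corresponding points of its coset cover the unit ball.\<close>

definition near_translates :: "('a::euclidean_space \<Rightarrow> real) set" where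
  "near_translates = Basis \<rightarrow>\<^sub>E {-1, 0, 1}"

lemma finite_near_translates: "finite (near_translates :: ('a::euclidean_space \<Rightarrow> real) set)"
  unfolding near_translates_def by (intro finite_PiE) auto

lemma inner_translate_Basis: "b \<in> Basis \<Longrightarrow> translate e \<bullet> b = e b"
  by (simp add: translate_def)

lemma inner_half_sum_Basis:
  assumes "S \<subseteq> Basis" "b \<in> Basis"
  shows "half_sum S \<bullet> b = (if b \<in> S then 1/2 else 0)"
proof -
  have "half_sum S \<bullet> b = (1/2) * (\<Sum>c\<in>S. if c = b then 1 else 0)"
    unfolding half_sum_def inner_scaleR_left inner_sum_left
    using assms by (intro arg_cong2 [of _ _ _ _ "(*)"] sum.cong refl) (auto simp: inner_Basis)
  then show ?thesis
    using finite_subset [OF assms(1) finite_Basis] by (cases "b \<in> S") auto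
qed

lemma unit_ball_covered_by_cells:
  fixes x :: "'a::euclidean_space"
  assumes "S \<subseteq> Basis" "norm x \<le> 1"
  obtains e where "e \<in> near_translates" "x - (half_sum S + translate e) \<in> unit_cell"
proof
  define e where "e = (\<lambda>b\<in>Basis. real_of_int (round (x \<bullet> b - half_sum S \<bullet> b)))"
  have "e b \<in> {-1, 0, 1}" if b: "b \<in> Basis" for b
  proof -
    have "\<bar>x \<bullet> b\<bar> \<le> 1" using Basis_le_norm [OF b, of x] assms(2) by simp
    then have "- 3 / 2 \<le> x \<bullet> b - half_sum S \<bullet> b" "x \<bullet> b - half_sum S \<bullet> b \<le> 1"
      using inner_half_sum_Basis [OF assms(1) b] by (auto split: if_splits)
    then have "-1 \<le> round (x \<bullet> b - half_sum S \<bullet> b)" "round (x \<bullet> b - half_sum S \<bullet> b) \<le> 1"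
      unfolding round_def by linarith+
    then have "round (x \<bullet> b - half_sum S \<bullet> b) \<in> {-1, 0, 1}" by auto
    then show ?thesis using b by (auto simp: e_def)
  qed
  then show "e \<in> near_translates" by (auto simp: near_translates_def e_def)
  show "x - (half_sum S + translate e) \<in> unit_cell"
    unfolding mem_unit_cell
  proof
    fix b :: 'a assume b: "b \<in> Basis"
    have coord: "(x - (half_sum S + translate e)) \<bullet> b
        = (x \<bullet> b - half_sum S \<bullet> b) - of_int (round (x \<bullet> b - half_sum S \<bullet> b))"
      using b by (simp add: inner_diff_left inner_add_left inner_translate_Basis e_def)
    show "- 1 / 2 \<le> (x - (half_sum S + translate e)) \<bullet> b
        \<and> (x - (half_sum S + translate e)) \<bullet> b \<le> 1 / 2"
      using of_int_round_abs_le [of "x \<bullet> b - half_sum S \<bullet> b"]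
      unfolding coord by (intro conjI) linarith+
  qed
qed

text \<open>By periodicity, the kernel on the cell around each point of the coset is a copy of the kernel on the
cell around the origin. An inequality is enough, so the overlaps of the cells do no harm.\<close>

lemma integral_le_sum_over_cells:
  fixes g :: "'a::euclidean_space \<Rightarrow> real"
  assumes cont: "continuous_on UNIV g" and nonneg: "\<And>x. g x \<ge> 0"
    and support: "\<And>x. norm x > 1 \<Longrightarrow> g x = 0" and S: "S \<subseteq> Basis"
  shows "(LINT x|lborel. g x * fejer_kernel N (x - half_sum S))
    \<le> (\<Sum>e\<in>near_translates. LINT x:unit_cell|lborel.
          g (x + (half_sum S + translate e)) * fejer_kernel N x)"
proof -
  define G where "G e x = indicator unit_cell x *\<^sub>R (g (x + (half_sum S + translate e)) * fejer_kernel N x)"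
    for e x
  have G: "integrable lborel (G e)" for e
    unfolding G_def [abs_def]
    by (intro borel_integrable_compact compact_unit_cell continuous_intros
        continuous_on_compose2 [OF cont]) auto
  have periodic: "fejer_kernel N (x - (half_sum S + translate e)) = fejer_kernel N (x - half_sum S)"
    if "e \<in> near_translates" for x e
  proof -
    have "translate e \<bullet> b \<in> \<int>" if "b \<in> Basis" for b
      using \<open>e \<in> near_translates\<close> that
      by (fastforce simp: near_translates_def inner_translate_Basis PiE_iff)
    then show ?thesis
      using fejer_kernel_periodic [of "translate e" N "x - (half_sum S + translate e)"]
      by (simp add: algebra_simps)
  qed
  have "(LINT x|lborel. g x * fejer_kernel N (x - half_sum S))
      \<le> (LINT x|lborel. (\<Sum>e\<in>near_translates. G e (x - (half_sum S + translate e))))"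
  proof (rule integral_mono')
    show "integrable lborel (\<lambda>x. \<Sum>e\<in>near_translates. G e (x - (half_sum S + translate e)))"
      by (intro Bochner_Integration.integrable_sum lborel_translation G)
    fix x :: 'a
    have terms: "G e (x - (half_sum S + translate e)) \<ge> 0" for e
      by (simp add: G_def nonneg fejer_kernel_nonneg)
    then show "0 \<le> (\<Sum>e\<in>near_translates. G e (x - (half_sum S + translate e)))"
      by (intro sum_nonneg)
    show "g x * fejer_kernel N (x - half_sum S)
        \<le> (\<Sum>e\<in>near_translates. G e (x - (half_sum S + translate e)))"
    proof (cases "norm x \<le> 1")
      case True
      then obtain e where e: "e \<in> near_translates" "x - (half_sum S + translate e) \<in> unit_cell"
        using unit_ball_covered_by_cells [OF S] by blast
      then have "g x * fejer_kernel N (x - half_sum S) = G e (x - (half_sum S + translate e))"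
        by (simp add: G_def periodic)
      also have "\<dots> \<le> (\<Sum>e\<in>near_translates. G e (x - (half_sum S + translate e)))"
        using e(1) terms by (intro member_le_sum finite_near_translates) auto
      finally show ?thesis .
    next
      case False
      then show ?thesis using support [of x] terms by (simp add: sum_nonneg)
    qed
  qed
  also have "\<dots> = (\<Sum>e\<in>near_translates. LINT x|lborel. G e x)"
    by (simp add: Bochner_Integration.integral_sum lborel_translation G)
  finally show ?thesis
    by (simp add: set_lebesgue_integral_def G_def)
qed

lemma inner_code_point_Basis:
  assumes "S \<subseteq> Basis" "b \<in> Basis"
  shows "(half_sum S + translate e) \<bullet> b = (if b \<in> S then 1/2 else 0) + e b"
  by (simp add: inner_add_left inner_half_sum_Basis [OF assms] inner_translate_Basis [OF assms(2)])

lemma near_translates_values: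
  assumes "e \<in> near_translates" "b \<in> Basis"
  shows "e b = -1 \<or> e b = 0 \<or> e b = 1"
  using assms by (auto simp: near_translates_def)

text \<open>The minimum distance \<open>4\<close> of the code matches the minimum distance \<open>1\<close> of \<open>\<int>\<^sup>n\<close>: a point of a coset with
\<open>|S| \<ge> 4\<close> has at least four entries of absolute value at least \<open>1/2\<close>.\<close>

lemma norm_ge_1_of_code_point:
  fixes S :: "'a::euclidean_space set"
  assumes S: "S \<subseteq> Basis" "S = {} \<or> 4 \<le> card S"
    and e: "e \<in> near_translates" and nz: "half_sum S + translate e \<noteq> 0"
  shows "norm (half_sum S + translate e) \<ge> 1"
proof -
  define p where "p = half_sum S + translate e"
  have coord: "p \<bullet> b = (if b \<in> S then 1/2 else 0) + e b" if "b \<in> Basis" for b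
    unfolding p_def by (rule inner_code_point_Basis [OF S(1) that])
  have e_values: "e b \<in> {-1, 0, 1}" if "b \<in> Basis" for b
    using near_translates_values [OF e that] by blast
  consider "S = {}" | "4 \<le> card S" using S(2) by blast
  then have "norm p \<ge> 1"
  proof cases
    case 1
    obtain b where b: "b \<in> Basis" "p \<bullet> b \<noteq> 0"
      using nz unfolding p_def [symmetric] using euclidean_all_zero_iff by blast
    then have "\<bar>p \<bullet> b\<bar> = 1" using 1 coord [of b] e_values [of b] by auto
    then show ?thesis using Basis_le_norm [OF b(1), of p] by simp
  next
    case 2
    have "1 \<le> (\<Sum>b\<in>S. (1/4::real))" using 2 by simp
    also have "\<dots> \<le> (\<Sum>b\<in>S. (p \<bullet> b)\<^sup>2)"
    proof (rule sum_mono)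
      fix b assume "b \<in> S"
      then have "p \<bullet> b \<in> {-1/2, 1/2, 3/2}" using S(1) coord [of b] e_values [of b] by auto
      then have "1/2 \<le> \<bar>p \<bullet> b\<bar>" by auto
      from power_mono [OF this, of 2] show "1/4 \<le> (p \<bullet> b)\<^sup>2" by (simp add: power_divide)
    qed
    also have "\<dots> \<le> (\<Sum>b\<in>Basis. (p \<bullet> b)\<^sup>2)"
      using S(1) by (intro sum_mono2) auto
    also have "\<dots> = (norm p)\<^sup>2"
      unfolding power2_norm_eq_inner using euclidean_inner [of p p] by (simp add: power2_eq_square)
    finally have "1\<^sup>2 \<le> (norm p)\<^sup>2" by simp
    then show ?thesis by (rule power2_le_imp_le) simp
  qed
  then show ?thesis by (simp add: p_def)
qed

text \<open>Replacing \<open>f\<close> by its positive part \<open>g\<close> only increases the integral against the nonnegative kernel, and it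
localizes the integral: \<open>g\<close> is continuous and vanishes where \<open>norm x \<ge> 1\<close>, so finitely
many cells matter. Boundary points of the unit ball may belong to the configuration, but \<open>g\<close> vanishes
there too.\<close>

lemma delsarte_weights_bound:
  fixes f :: "'a::euclidean_space \<Rightarrow> real" and w :: "'a set \<Rightarrow> real"
  assumes f: "continuous_on UNIV f" "integrable lborel f" "f 0 > 0"
    and sign: "\<And>x. norm x \<ge> 1 \<Longrightarrow> f x \<le> 0"
    and fourier: "\<And>y. fourier f y \<ge> 0"
    and w: "\<And>S. w S \<ge> 0" "w {} = 1"
    and distance: "\<And>S. S \<subseteq> Basis \<Longrightarrow> S \<noteq> {} \<Longrightarrow> card S < 4 \<Longrightarrow> w S = 0"
    and spectrum: "\<And>T. T \<subseteq> Basis \<Longrightarrow> (\<Sum>S\<in>Pow Basis. w S * (-1) ^ card (S \<inter> T)) \<ge> 0"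
  shows "(\<Sum>S\<in>Pow Basis. w S) * Re (fourier f 0) \<le> f 0"
proof -
  define g where "g x = max (f x) 0" for x
  have g_cont: "continuous_on UNIV g" unfolding g_def [abs_def] by (intro continuous_intros f)
  have g_nonneg: "g x \<ge> 0" for x by (simp add: g_def)
  have g_outside: "g x = 0" if "norm x \<ge> 1" for x using sign [OF that] by (simp add: g_def)
  have g_integrable: "integrable lborel (\<lambda>x. g x * h x)" if "continuous_on UNIV h" for h
  proof -
    have "integrable lborel (\<lambda>x. indicator (cball 0 1) x *\<^sub>R (g x * h x))"
      by (intro borel_integrable_compact compact_cball continuous_intros)
         (auto intro: continuous_on_subset [OF g_cont] continuous_on_subset [OF that])
    moreover have "indicator (cball 0 1) x *\<^sub>R (g x * h x) = g x * h x" for x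
      using g_outside [of x] by (auto simp: indicator_def)
    ultimately show ?thesis by (simp only:)
  qed
  have weights_cont: "continuous_on UNIV (smoothed_weights w N)" for N
    unfolding smoothed_weights_def [abs_def] by (intro continuous_intros)
  have weights_nonneg: "smoothed_weights w N x \<ge> 0" for N x
    unfolding smoothed_weights_def by (intro sum_nonneg mult_nonneg_nonneg w fejer_kernel_nonneg)
  define U where "U N = (\<Sum>S\<in>Pow Basis. w S * (\<Sum>e\<in>near_translates.
      LINT x:unit_cell|lborel. g (x + (half_sum S + translate e)) * fejer_kernel N x))" for N
  have lower: "(\<Sum>S\<in>Pow Basis. w S) * Re (fourier f 0) \<le> U N" if "N \<ge> 1" for N
  proof -
    have "(\<Sum>S\<in>Pow Basis. w S) * Re (fourier f 0) \<le> (LINT x|lborel. f x * smoothed_weights w N x)"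
      using that by (intro weighted_transform_le_integral f fourier spectrum) auto
    also have "\<dots> \<le> (LINT x|lborel. g x * smoothed_weights w N x)"
      using weights_nonneg
      by (intro integral_mono' g_integrable weights_cont mult_right_mono mult_nonneg_nonneg g_nonneg)
         (auto simp: g_def)
    also have "\<dots> = (LINT x|lborel. (\<Sum>S\<in>Pow Basis. w S * (g x * fejer_kernel N (x - half_sum S))))"
      unfolding smoothed_weights_def by (simp add: sum_distrib_left mult_ac)
    also have "\<dots> = (\<Sum>S\<in>Pow Basis. w S * (LINT x|lborel. g x * fejer_kernel N (x - half_sum S)))"
      by (subst Bochner_Integration.integral_sum)
         (auto intro!: integrable_mult_right g_integrable continuous_intros)
    also have "\<dots> \<le> U N"
      unfolding U_def
      by (intro sum_mono mult_left_mono integral_le_sum_over_cells g_cont g_nonneg g_outside w) auto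
    finally show ?thesis .
  qed
  have limit: "U \<longlonglongrightarrow> (\<Sum>S\<in>Pow Basis. w S * (\<Sum>e\<in>near_translates. g (half_sum S + translate e)))"
    unfolding U_def [abs_def]
  proof (intro tendsto_sum tendsto_mult tendsto_const)
    fix S and e :: "'a \<Rightarrow> real"
    have "continuous_on UNIV (\<lambda>x. g (x + (half_sum S + translate e)))"
      by (intro continuous_on_compose2 [OF g_cont] continuous_intros) auto
    from fejer_kernel_approximate_identity [OF this]
    show "(\<lambda>N. LINT x:unit_cell|lborel. g (x + (half_sum S + translate e)) * fejer_kernel N x)
        \<longlonglongrightarrow> g (half_sum S + translate e)"
      by simp
  qed
  have "(\<Sum>S\<in>Pow Basis. w S * (\<Sum>e\<in>near_translates. g (half_sum S + translate e)))
      = (\<Sum>S\<in>Pow (Basis :: 'a set). if S = {} then f 0 else 0)"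
  proof (rule sum.cong)
    fix S :: "'a set" assume "S \<in> Pow Basis"
    then have S: "S \<subseteq> Basis" by simp
    show "w S * (\<Sum>e\<in>near_translates. g (half_sum S + translate e)) = (if S = {} then f 0 else 0)"
    proof (cases "S = {}")
      case True
      define zero_choice :: "'a \<Rightarrow> real" where "zero_choice = (\<lambda>b\<in>Basis. 0)"
      have zero_choice: "zero_choice \<in> near_translates" by (auto simp: zero_choice_def near_translates_def)
      have "g (half_sum S + translate e) = 0" if e: "e \<in> near_translates - {zero_choice}" for e
      proof -
        have "\<exists>b\<in>Basis. e b \<noteq> 0"
        proof (rule ccontr)
          assume none: "\<not> (\<exists>b\<in>Basis. e b \<noteq> 0)"
          have "e = zero_choice"
          proof
            fix b
            have "e b = undefined" if "b \<notin> Basis"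
              using e PiE_arb [OF _ that, of e "\<lambda>_. {-1, 0, 1}"] by (simp add: near_translates_def)
            then show "e b = zero_choice b" using none by (cases "b \<in> Basis") (auto simp: zero_choice_def)
          qed
          then show False using e by simp
        qed
        then obtain b where b: "b \<in> Basis" "e b \<noteq> 0" by blast
        then have "(half_sum S + translate e) \<bullet> b \<noteq> 0"
          unfolding inner_code_point_Basis [OF S b(1)] using True by simp
        then have "half_sum S + translate e \<noteq> 0" by (intro notI) (simp only: inner_zero_left)
        moreover have "e \<in> near_translates" using e by (rule DiffD1)
        ultimately show ?thesis
          using g_outside [OF norm_ge_1_of_code_point [OF S disjI1 [OF True]]] by blast
      qed
      then have "(\<Sum>e\<in>near_translates - {zero_choice}. g (half_sum S + translate e)) = 0"
        by (rule sum.neutral [OF ballI])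
      then have "(\<Sum>e\<in>near_translates. g (half_sum S + translate e)) = g (half_sum S + translate zero_choice)"
        unfolding sum.remove [OF finite_near_translates zero_choice] by (simp only: add_0_right)
      also have "half_sum S + translate zero_choice = 0"
        by (simp add: True half_sum_def translate_def zero_choice_def)
      also have "g 0 = f 0" using f(3) by (simp add: g_def)
      finally show ?thesis using True w(2) by (simp only: mult_1_left refl if_True)
    next
      case False
      show ?thesis
      proof (cases "card S < 4")
        case True
        then have "w S = 0" by (rule distance [OF S False])
        then show ?thesis using False by (simp only: mult_zero_left if_False)
      next
        case card: False
        have vanish: "g (half_sum S + translate e) = 0" if e: "e \<in> near_translates" for e
        proof -
          obtain b where b: "b \<in> S" using False by blast
          then have bB: "b \<in> Basis" using S by blast
          have "(half_sum S + translate e) \<bullet> b = 1/2 + e b"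
            using inner_code_point_Basis [OF S bB] b by (simp only: if_True)
          then have "(half_sum S + translate e) \<bullet> b \<noteq> 0"
            using near_translates_values [OF e bB] by linarith
          then have "half_sum S + translate e \<noteq> 0" by (intro notI) (simp only: inner_zero_left)
          moreover have "4 \<le> card S" using card by linarith
          ultimately show ?thesis
            using g_outside [OF norm_ge_1_of_code_point [OF S disjI2 e]] by blast
        qed
        have "(\<Sum>e\<in>near_translates. g (half_sum S + translate e)) = 0"
          by (rule sum.neutral [OF ballI [OF vanish]])
        then show ?thesis using False by (simp only: mult_zero_right if_False)
      qed
    qed
  qed simp
  also have "\<dots> = f 0"
    by (subst sum.delta) (simp_all only: finite_Pow_iff finite_Basis empty_subsetI Pow_iff if_True refl)
  finally have "U \<longlonglongrightarrow> f 0" using limit by (simp only:)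
  then show ?thesis
    by (rule LIMSEQ_le_const) (intro exI [of _ 1] allI impI lower)
qed

section \<open>From weights to the linear programming bound\<close>

text \<open>The Bochner integral of a non-integrable function is \<open>0\<close> by convention. So the constraint
\<open>fourier f 0 \<ge> 1\<close> already forces \<open>f\<close> to be integrable.\<close>

lemma integrable_if_fourier_nonzero:
  assumes "fourier f 0 \<noteq> 0"
  shows "integrable lborel f"
proof -
  have "integrable lborel (\<lambda>x. complex_of_real (f x))"
    using assms not_integrable_integral_eq by (fastforce simp: fourier_def)
  then show ?thesis by (simp only: complex_of_real_integrable_eq)
qed

lemma fourier_dilation:
  fixes f :: "'a::euclidean_space \<Rightarrow> real"
  assumes f: "continuous_on UNIV f" and r: "r > 0"
  shows "fourier (\<lambda>x. f (r *\<^sub>R x)) y = fourier f (y /\<^sub>R r) / of_real (r ^ DIM('a))"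
proof -
  define G where "G x = complex_of_real (f x)
      * exp (- 2 * complex_of_real pi * \<i> * complex_of_real (x \<bullet> (y /\<^sub>R r)))" for x
  have [measurable]: "G \<in> borel_measurable borel"
    unfolding G_def [abs_def] by (intro borel_measurable_continuous_onI continuous_intros f)
  have cancel: "(r *\<^sub>R x) \<bullet> (y /\<^sub>R r) = x \<bullet> y" for x
    using r by simp
  have "fourier f (y /\<^sub>R r) = integral\<^sup>L lborel G"
    by (simp add: fourier_def G_def [abs_def])
  also have "\<dots> = integral\<^sup>L (density (distr lborel borel (\<lambda>x. 0 + r *\<^sub>R x)) (\<lambda>_. \<bar>r\<bar> ^ DIM('a))) G"
    using lborel_affine [of r "0 :: 'a"] r by simp
  also have "\<dots> = (LINT x|lborel. r ^ DIM('a) *\<^sub>R G (r *\<^sub>R x))"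
    using r by (subst integral_density) (auto simp: integral_distr)
  also have "\<dots> = of_real (r ^ DIM('a)) * fourier (\<lambda>x. f (r *\<^sub>R x)) y"
    unfolding fourier_def integral_scaleR_right G_def scaleR_conv_of_real [of "r ^ DIM('a)"]
    unfolding cancel by simp
  finally show ?thesis using r by simp
qed

text \<open>Dilation by \<open>r\<close> reduces this to the case \<open>r = 1\<close>: it divides the Fourier transform at \<open>0\<close> by \<open>r\<^sup>n\<close>,
which is compensated by the factor \<open>(r/2)\<^sup>n\<close> in the objective function.\<close>

lemma cohn_elkies_bound_ge_delsarte_weights:
  fixes w :: "'a::euclidean_space set \<Rightarrow> real"
  assumes r: "r > 0"
    and w: "\<And>S. w S \<ge> 0" "w {} = 1"
    and distance: "\<And>S. S \<subseteq> Basis \<Longrightarrow> S \<noteq> {} \<Longrightarrow> card S < 4 \<Longrightarrow> w S = 0"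
    and spectrum: "\<And>T. T \<subseteq> Basis \<Longrightarrow> (\<Sum>S\<in>Pow Basis. w S * (-1) ^ card (S \<inter> T)) \<ge> 0"
  shows "cohn_elkies_bound TYPE('a) r \<ge> ereal ((\<Sum>S\<in>Pow Basis. w S) / 2 ^ DIM('a))"
  unfolding cohn_elkies_bound_def
proof (rule INF_greatest)
  fix f :: "'a \<Rightarrow> real" assume "f \<in> cohn_elkies_feasible r"
  then have smooth: "smooth f" and f0: "f 0 > 0" and fourier0: "fourier f 0 \<ge> 1"
    and sign: "\<And>x. norm x \<ge> r \<Longrightarrow> f x \<le> 0" and fourier: "\<And>y. fourier f y \<ge> 0"
    unfolding cohn_elkies_feasible_def by blast+
  have cont: "continuous_on UNIV f"
    using spec [OF smooth [unfolded smooth_def], of 0] by simp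
  define h where "h x = f (r *\<^sub>R x)" for x
  have h_fourier: "fourier h y = fourier f (y /\<^sub>R r) / of_real (r ^ DIM('a))" for y
    unfolding h_def [abs_def] by (rule fourier_dilation [OF cont r])
  have "Re (fourier f 0) \<ge> 1" using fourier0 by (simp add: less_eq_complex_def)
  then have h0: "Re (fourier h 0) \<ge> 1 / r ^ DIM('a)"
    unfolding h_fourier Re_divide_of_real using r by (simp add: divide_right_mono)
  have "(\<Sum>S\<in>Pow Basis. w S) * Re (fourier h 0) \<le> h 0"
  proof (rule delsarte_weights_bound [where f = h and w = w])
    show "continuous_on UNIV h"
      unfolding h_def [abs_def] by (intro continuous_on_compose2 [OF cont] continuous_intros) auto
    have "Re (fourier h 0) > 0" using h0 r by (intro less_le_trans [OF _ h0]) simp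
    then show "integrable lborel h" by (intro integrable_if_fourier_nonzero) auto
    show "h 0 > 0" by (simp add: h_def f0)
    show "h x \<le> 0" if "norm x \<ge> 1" for x
      using that r by (simp add: h_def sign)
    show "fourier h y \<ge> 0" for y
      using fourier [of "y /\<^sub>R r"] r
      unfolding h_fourier less_eq_complex_def Re_divide_of_real Im_divide_of_real by simp
  qed (fact w distance spectrum)+
  moreover have "(\<Sum>S\<in>Pow Basis. w S) * (1 / r ^ DIM('a)) \<le> (\<Sum>S\<in>Pow Basis. w S) * Re (fourier h 0)"
    by (intro mult_left_mono h0 sum_nonneg w)
  ultimately have "(\<Sum>S\<in>Pow Basis. w S) / r ^ DIM('a) \<le> f 0" by (simp add: h_def)
  then have "(r / 2) ^ DIM('a) * ((\<Sum>S\<in>Pow Basis. w S) / r ^ DIM('a)) \<le> (r / 2) ^ DIM('a) * f 0"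
    using r by (intro mult_left_mono) simp_all
  then have "(\<Sum>S\<in>Pow Basis. w S) / 2 ^ DIM('a) \<le> (r / 2) ^ DIM('a) * f 0"
    using r by (simp add: power_divide)
  then show "ereal ((\<Sum>S\<in>Pow Basis. w S) / 2 ^ DIM('a)) \<le> ereal ((r / 2) ^ DIM('a) * f 0)"
    by simp
qed

section \<open>The weights in dimension twelve\<close>

lemma sum_Pow_card:
  assumes "finite A"
  shows "(\<Sum>S\<in>Pow A. h (card S)) = (\<Sum>k\<le>card A. real (card A choose k) * h k)"
proof -
  have "(\<Sum>S\<in>Pow A. h (card S)) = (\<Sum>k\<le>card A. \<Sum>S\<in>{S\<in>Pow A. card S = k}. h (card S))"
    using assms by (intro sum.group [symmetric]) (auto intro: card_mono)
  also have "\<dots> = (\<Sum>k\<le>card A. real (card A choose k) * h k)"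
    using assms by (intro sum.cong) (simp_all add: n_subsets)
  finally show ?thesis .
qed

text \<open>Splitting a subset \<open>S\<close> into \<open>S \<inter> T\<close> and \<open>S - T\<close> expresses the transform of a weight that depends on
\<open>card S\<close> only by binomial coefficients, that is, by values of Krawtchouk polynomials.\<close>

lemma krawtchouk_sum:
  assumes "finite A" "T \<subseteq> A"
  shows "(\<Sum>S\<in>Pow A. h (card S) * (-1) ^ card (S \<inter> T))
    = (\<Sum>i\<le>card T. real (card T choose i) * (\<Sum>j\<le>card A - card T.
         real (card A - card T choose j) * (h (i + j) * (-1) ^ i)))"
proof -
  have fin: "finite T" "finite (A - T)" and card: "card (A - T) = card A - card T"
    using assms finite_subset [OF assms(2,1)] by (auto intro: card_Diff_subset)
  have "(\<Sum>S\<in>Pow A. h (card S) * (-1) ^ card (S \<inter> T))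
      = (\<Sum>(P,Q)\<in>Pow T \<times> Pow (A - T). h (card P + card Q) * (-1) ^ card P)"
  proof (rule sum.reindex_bij_witness [where j = "\<lambda>S. (S \<inter> T, S - T)" and i = "\<lambda>(P,Q). P \<union> Q"])
    fix S assume "S \<in> Pow A"
    then have "finite S" using assms(1) finite_subset by auto
    then have "card S = card (S \<inter> T) + card (S - T)"
      by (metis Int_Diff_Un Int_Diff_disjoint card_Un_disjoint finite_Diff finite_Int)
    then show "(case (S \<inter> T, S - T) of (P, Q) \<Rightarrow> h (card P + card Q) * (-1) ^ card P)
        = h (card S) * (-1) ^ card (S \<inter> T)" by simp
  qed (use assms(2) in auto)
  also have "\<dots> = (\<Sum>P\<in>Pow T. \<Sum>Q\<in>Pow (A - T). h (card P + card Q) * (-1) ^ card P)"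
    by (simp add: sum.cartesian_product)
  also have "\<dots> = (\<Sum>P\<in>Pow T. \<Sum>j\<le>card A - card T.
      real (card A - card T choose j) * (h (card P + j) * (-1) ^ card P))"
    unfolding card [symmetric]
    by (intro sum.cong refl sum_Pow_card [OF fin(2), of "\<lambda>j. h (card P + j) * (-1) ^ card P" for P])
  finally show ?thesis
    by (simp only: sum_Pow_card [OF fin(1), of "\<lambda>i. \<Sum>j\<le>card A - card T.
      real (card A - card T choose j) * (h (i + j) * (-1) ^ i)"])
qed

text \<open>The weights are found from their transform. Let the transform be \<open>\<alpha>\<close> at the sets of size \<open>0\<close> and \<open>12\<close>,
\<open>\<beta>\<close> at those of size \<open>6\<close>, and \<open>0\<close> elsewhere. By Fourier inversion the weight at a set of size \<open>k\<close> is
\<open>(\<alpha> (1 + (-1)\<^sup>k) + \<beta> K(k)) / 2\<^sup>1\<^sup>2\<close>, where \<open>K\<close> is the sixth Krawtchouk polynomial. It satisfies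
\<open>K(12 - k) = K(k)\<close> and vanishes at odd \<open>k\<close>, so the weights vanish at odd sizes and are symmetric.
As \<open>K(0) = 924\<close> and \<open>K(2) = -84\<close>, weight \<open>0\<close> at size \<open>2\<close> means \<open>\<alpha> = 42 \<beta>\<close>, and weight \<open>1\<close> at
size \<open>0\<close> then gives \<open>\<beta> = 256/63\<close> and \<open>\<alpha> = 512/3\<close>. The remaining weights turn out to be positive.\<close>

definition extremal_weight :: "nat \<Rightarrow> real" where
  "extremal_weight k = (if k = 0 \<or> k = 12 then 1 else if k = 4 \<or> k = 8 then 1 / 9
                 else if k = 6 then 4 / 63 else 0)"

lemma extremal_weight_transform:
  fixes T :: "'a::euclidean_space set"
  assumes "DIM('a) = 12" "T \<subseteq> Basis"
  shows "(\<Sum>S\<in>Pow Basis. extremal_weight (card S) * (-1) ^ card (S \<inter> T)) =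
    (if card T = 0 \<or> card T = 12 then 512 / 3 else if card T = 6 then 256 / 63 else 0)"
proof -
  have "card T \<le> 12" using card_mono [OF finite_Basis assms(2)] assms(1) by simp
  then have "card T \<in> {0,1,2,3,4,5,6,7,8,9,10,11,12}"
    unfolding insert_iff empty_iff by arith
  then show ?thesis
    unfolding krawtchouk_sum [OF finite_Basis assms(2)] assms(1)
    by (elim insertE emptyE)
       (simp_all add: extremal_weight_def binomial_fact' atMost_nat_numeral fact_numeral)
qed

theorem theorem8p6:
  fixes r :: real
  assumes "r > 0"
  shows "cohn_elkies_bound TYPE(real ^ 12) r \<ge> ereal (1 / 24) \<and> (1 / 24 :: real) > 0.04166666"
proof
  have dim: "DIM(real ^ 12) = 12" by simp
  have "cohn_elkies_bound TYPE(real ^ 12) r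
      \<ge> ereal ((\<Sum>S\<in>Pow (Basis :: (real ^ 12) set). extremal_weight (card S)) / 2 ^ DIM(real ^ 12))"
  proof (rule cohn_elkies_bound_ge_delsarte_weights [OF assms])
    fix T :: "(real ^ 12) set" assume "T \<subseteq> Basis"
    then show "(\<Sum>S\<in>Pow Basis. extremal_weight (card S) * (-1) ^ card (S \<inter> T)) \<ge> 0"
      by (simp add: extremal_weight_transform [OF dim])
  next
    fix S :: "(real ^ 12) set" assume "S \<subseteq> Basis" "S \<noteq> {}" "card S < 4"
    then have "card S \<noteq> 0" using finite_subset [OF \<open>S \<subseteq> Basis\<close> finite_Basis] by simp
    with \<open>card S < 4\<close> show "extremal_weight (card S) = 0" by (simp add: extremal_weight_def)
  qed (auto simp: extremal_weight_def)
  also have "(\<Sum>S\<in>Pow (Basis :: (real ^ 12) set). extremal_weight (card S)) = 512 / 3"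
    using extremal_weight_transform [OF dim, of "{}"] by simp
  finally show "cohn_elkies_bound TYPE(real ^ 12) r \<ge> ereal (1 / 24)" by simp
qed simp

end
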